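(* The set of primitive vectors of norm $0$ in the lattice $\mathrm{II}_{1,9}$ is non-empty and forms exactly one orbit under $\mathrm{Aut}(\mathrm{II}_{1,9})$.
   Context: $\mathrm{II}_{1,9}$ denotes the even unimodular lattice of signature $(1,9)$, which is unique up to isometry; explicitly $\mathrm{II}_{1,9}\cong U\oplus(-E_8)$, where $U=\mathbb{Z}^2$ with Gram matrix $\begin{pmatrix}0&1\\1&0\end{pmatrix}$ and $(-E_8)$ is the $E_8$ root lattice with its bilinear form negated. The norm of $u$ is $u^2=u\cdot u$. $\mathrm{Aut}(\mathrm{II}_{1,9})$ is the group of all $\mathbb{Z}$-linear automorphisms of the lattice preserving the bilinear form. A vector $u$ in a lattice $\Gamma$ is primitive if there is no integer $k>1$ with $u\in k\Gamma$ (in particular $0$ is not primitive). *)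

theory Defs
  imports "HOL-Analysis.Analysis" "HOL-Algebra.Group_Action"
begin

text \<open>
  A lattice is a subgroup of a real vector space together with a bilinear form on that space;
  only the values of the form on the lattice matter.
\<close>

record 'a zlattice =
  vecs :: "'a set"
  form :: "'a \<Rightarrow> 'a \<Rightarrow> real"

definition neg_lattice :: "'a zlattice \<Rightarrow> 'a zlattice" where
  "neg_lattice \<Gamma> = \<lparr>vecs = vecs \<Gamma>, form = (\<lambda>x y. - form \<Gamma> x y)\<rparr>"

definition orth_sum :: "'a zlattice \<Rightarrow> 'b zlattice \<Rightarrow> ('a \<times> 'b) zlattice" where
  "orth_sum \<Gamma> \<Delta> =
     \<lparr>vecs = vecs \<Gamma> \<times> vecs \<Delta>,
      form = (\<lambda>x y. form \<Gamma> (fst x) (fst y) + form \<Delta> (snd x) (snd y))\<rparr>"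

definition vec_norm :: "'a zlattice \<Rightarrow> 'a \<Rightarrow> real" where
  "vec_norm \<Gamma> u = form \<Gamma> u u"

definition primitive_in :: "'a::real_vector zlattice \<Rightarrow> 'a \<Rightarrow> bool" where
  "primitive_in \<Gamma> u \<longleftrightarrow>
     u \<in> vecs \<Gamma> \<and> \<not> (\<exists>k::int. k > 1 \<and> u \<in> (\<lambda>w. of_int k *\<^sub>R w) ` vecs \<Gamma>)"

definition primitive_null :: "'a::real_vector zlattice \<Rightarrow> 'a set" where
  "primitive_null \<Gamma> = {u. primitive_in \<Gamma> u \<and> vec_norm \<Gamma> u = 0}"

text \<open>
  As in \<^const>\<open>BijGroup\<close>, automorphisms are taken to be extensional, so that each automorphism
  is represented by a single function.
\<close>

definition lattice_auts :: "'a::real_vector zlattice \<Rightarrow> ('a \<Rightarrow> 'a) set" where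
  "lattice_auts \<Gamma> =
     {f \<in> Bij (vecs \<Gamma>).
        (\<forall>x\<in>vecs \<Gamma>. \<forall>y\<in>vecs \<Gamma>. \<forall>m n :: int.
           f (of_int m *\<^sub>R x + of_int n *\<^sub>R y) = of_int m *\<^sub>R f x + of_int n *\<^sub>R f y) \<and>
        (\<forall>x\<in>vecs \<Gamma>. \<forall>y\<in>vecs \<Gamma>. form \<Gamma> (f x) (f y) = form \<Gamma> x y)}"

definition Aut :: "'a::real_vector zlattice \<Rightarrow> ('a \<Rightarrow> 'a) monoid" where
  "Aut \<Gamma> = BijGroup (vecs \<Gamma>) \<lparr>carrier := lattice_auts \<Gamma>\<rparr>"

definition U_gram :: "real^2^2" where
  "U_gram = vector [vector [0, 1], vector [1, 0]]"

definition U_lattice :: "(real^2) zlattice" where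
  "U_lattice = \<lparr>vecs = {x. \<forall>i. x $ i \<in> \<int>}, form = (\<lambda>x y. x \<bullet> (U_gram *v y))\<rparr>"

text \<open>
  The standard coordinates of the \<open>E\<^sub>8\<close> root lattice: all coordinates are integers or all are
  half-integers, and their sum is even.
\<close>

definition E8_lattice :: "(real^8) zlattice" where
  "E8_lattice =
     \<lparr>vecs = {x. ((\<forall>i. x $ i \<in> \<int>) \<or> (\<forall>i. x $ i - 1 / 2 \<in> \<int>)) \<and> (\<Sum>i\<in>UNIV. x $ i) / 2 \<in> \<int>},
      form = (\<bullet>)\<rparr>"

definition II_1_9 :: "((real^2) \<times> (real^8)) zlattice" where
  "II_1_9 = orth_sum U_lattice (neg_lattice E8_lattice)"


text \<open>Consistency checks: \<open>II_1_9\<close> is an even, self-dual lattice, and its \<open>Aut\<close> is a group.\<close>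

lemma U_form: "form U_lattice x y = x $ 1 * y $ 2 + x $ 2 * y $ 1"
  by (simp add: U_lattice_def U_gram_def inner_vec_def matrix_vector_mult_def sum_2)

lemma II_1_9_form: "form II_1_9 x y = form U_lattice (fst x) (fst y) - snd x \<bullet> snd y"
  by (simp add: II_1_9_def orth_sum_def neg_lattice_def E8_lattice_def)

lemma II_1_9_vecs: "vecs II_1_9 = vecs U_lattice \<times> vecs E8_lattice"
  by (simp add: II_1_9_def orth_sum_def neg_lattice_def)

lemma E8_even: assumes "x \<in> vecs E8_lattice" shows "x \<bullet> x / 2 \<in> \<int>"
proof -
  have s: "(\<Sum>i\<in>UNIV. x $ i) / 2 \<in> \<int>" using assms by (auto simp: E8_lattice_def)
  have c: "(a * (a - 1)) / 2 \<in> \<int>" if "a \<in> \<int>" for a :: real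
  proof -
    from that obtain k where k: "a = of_int k" by (rule Ints_cases)
    have "even (k * (k - 1))" by simp
    then obtain m where "k * (k - 1) = 2 * m" by blast
    then have "of_int (k * (k - 1)) = (of_int (2 * m) :: real)" by simp
    then have "a * (a - 1) / 2 = of_int m" using k by simp
    then show ?thesis by simp
  qed
  show ?thesis
  proof (cases "\<forall>i. x $ i \<in> \<int>")
    case True
    have q: "x \<bullet> x / 2 = (\<Sum>i\<in>UNIV. x $ i * (x $ i - 1) / 2) + (\<Sum>i\<in>UNIV. x $ i) / 2"
      unfolding inner_vec_def sum_divide_distrib sum.distrib [symmetric]
      by (intro sum.cong refl) (simp add: field_simps)
    show ?thesis unfolding q using True s c by (intro Ints_add Ints_sum) auto
  next
    case False
    then have h: "x $ i + 1 / 2 \<in> \<int>" for i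
      using assms Ints_add [of "x $ i - 1 / 2" 1] by (auto simp: E8_lattice_def add.commute)
    have q: "x \<bullet> x / 2 = (\<Sum>i\<in>UNIV. (x $ i + 1 / 2) * (x $ i + 1 / 2 - 1) / 2 + 1 / 8)"
      unfolding inner_vec_def sum_divide_distrib
      by (intro sum.cong refl) (simp add: field_simps)
    have "(\<Sum>i\<in>UNIV. (x $ i + 1 / 2) * (x $ i + 1 / 2 - 1) / 2) \<in> \<int>"
      using c [OF h] by (intro Ints_sum)
    then have "(\<Sum>i\<in>UNIV. (x $ i + 1 / 2) * (x $ i + 1 / 2 - 1) / 2) + 1 \<in> \<int>"
      by (intro Ints_add Ints_1)
    then show ?thesis unfolding q sum.distrib by simp
  qed
qed

lemma II_1_9_even:
  assumes "u \<in> vecs II_1_9" shows "vec_norm II_1_9 u / 2 \<in> \<int>"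
proof -
  have "vec_norm II_1_9 u / 2 = fst u $ 1 * fst u $ 2 - snd u \<bullet> snd u / 2"
    by (simp add: vec_norm_def II_1_9_form U_form field_simps)
  moreover have "fst u $ 1 * fst u $ 2 \<in> \<int>" "snd u \<bullet> snd u / 2 \<in> \<int>"
    using assms E8_even by (auto simp: II_1_9_vecs U_lattice_def)
  ultimately show ?thesis by (simp only: Ints_diff)
qed

lemma E8_dual:
  assumes y: "\<And>x. x \<in> vecs E8_lattice \<Longrightarrow> x \<bullet> y \<in> \<int>" shows "y \<in> vecs E8_lattice"
proof -
  have r: "y $ i + y $ j \<in> \<int>" for i j
  proof -
    have "axis i 1 + axis j 1 \<in> vecs E8_lattice"
      by (auto simp: E8_lattice_def axis_def sum.distrib)
    from y [OF this] show ?thesis by (simp add: inner_add_left inner_axis')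
  qed
  have d: "y $ i - y $ j \<in> \<int>" for i j
  proof -
    have "axis i 1 - axis j 1 \<in> vecs E8_lattice"
      by (auto simp: E8_lattice_def axis_def sum_subtractf)
    from y [OF this] show ?thesis by (simp add: inner_diff_left inner_axis')
  qed
  have "(\<chi> i. 1 / 2) \<in> vecs E8_lattice" by (simp add: E8_lattice_def)
  from y [OF this] have s: "(\<Sum>i\<in>UNIV. y $ i) / 2 \<in> \<int>"
    by (simp add: inner_vec_def sum_divide_distrib)
  from r [of 1 1] obtain k where k: "y $ 1 + y $ 1 = of_int k" by (rule Ints_cases)
  have "y $ 1 \<in> \<int> \<or> y $ 1 - 1 / 2 \<in> \<int>"
  proof (cases "even k")
    case True
    then obtain m where "k = 2 * m" by blast
    with k have "y $ 1 = of_int m" by simp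
    then show ?thesis by simp
  next
    case False
    then obtain m where "k = 2 * m + 1" by (elim oddE)
    with k have "y $ 1 - 1 / 2 = of_int m" by simp
    then show ?thesis by simp
  qed
  then have "(\<forall>i. y $ i \<in> \<int>) \<or> (\<forall>i. y $ i - 1 / 2 \<in> \<int>)"
  proof
    assume "y $ 1 \<in> \<int>"
    then have "y $ i \<in> \<int>" for i using Ints_add [OF d [of i 1]] by simp
    then show ?thesis by blast
  next
    assume "y $ 1 - 1 / 2 \<in> \<int>"
    then have "y $ i - 1 / 2 \<in> \<int>" for i using Ints_add [OF d [of i 1]] by fastforce
    then show ?thesis by blast
  qed
  with s show ?thesis by (simp add: E8_lattice_def)
qed

lemma E8_combination:
  assumes x: "x \<in> vecs E8_lattice" and y: "y \<in> vecs E8_lattice"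
  shows "of_int m *\<^sub>R x + of_int n *\<^sub>R y \<in> vecs E8_lattice"
proof -
  have sum: "x + y \<in> vecs E8_lattice"
    if "x \<in> vecs E8_lattice" "y \<in> vecs E8_lattice" for x y
  proof -
    have "(\<Sum>i\<in>UNIV. (x + y) $ i) / 2 = (\<Sum>i\<in>UNIV. x $ i) / 2 + (\<Sum>i\<in>UNIV. y $ i) / 2"
      by (simp add: sum.distrib add_divide_distrib)
    moreover have "(\<Sum>i\<in>UNIV. x $ i) / 2 \<in> \<int>" "(\<Sum>i\<in>UNIV. y $ i) / 2 \<in> \<int>"
      using that by (auto simp: E8_lattice_def)
    ultimately have s: "(\<Sum>i\<in>UNIV. (x + y) $ i) / 2 \<in> \<int>" by (simp only: Ints_add)
    have r: "(a::real) - 1 / 2 \<in> \<int> \<Longrightarrow> b \<in> \<int> \<Longrightarrow> a + b - 1 / 2 \<in> \<int>"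
      "a \<in> \<int> \<Longrightarrow> b - 1 / 2 \<in> \<int> \<Longrightarrow> a + b - 1 / 2 \<in> \<int>"
      "a - 1 / 2 \<in> \<int> \<Longrightarrow> b - 1 / 2 \<in> \<int> \<Longrightarrow> a + b \<in> \<int>" for a b
      using Ints_add [of "a - 1 / 2" b] Ints_add [of a "b - 1 / 2"]
        Ints_add [OF Ints_add [of "a - 1 / 2" "b - 1 / 2"] Ints_1] by (simp_all add: algebra_simps)
    have "(\<forall>i. (x + y) $ i \<in> \<int>) \<or> (\<forall>i. (x + y) $ i - 1 / 2 \<in> \<int>)"
      using that r by (auto simp: E8_lattice_def)
    with s show ?thesis by (simp add: E8_lattice_def)
  qed
  have neg: "- x \<in> vecs E8_lattice" if "x \<in> vecs E8_lattice" for x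
  proof -
    have "- a - 1 / 2 \<in> \<int>" if "a - 1 / 2 \<in> \<int>" for a :: real
      using Ints_diff [OF Ints_minus [OF that] Ints_1] by (simp add: algebra_simps)
    with that show ?thesis by (auto simp: E8_lattice_def sum_negf)
  qed
  have nat: "of_nat k *\<^sub>R x \<in> vecs E8_lattice" if "x \<in> vecs E8_lattice" for k x
  proof (induction k)
    case 0
    show ?case by (simp add: E8_lattice_def)
  next
    case (Suc k)
    then show ?case using sum [OF that] by (simp add: scaleR_add_left)
  qed
  have "of_int k *\<^sub>R x \<in> vecs E8_lattice" if "x \<in> vecs E8_lattice" for k :: int and x
    by (cases k rule: int_cases2) (use nat neg that in auto)
  with x y sum show ?thesis by blast
qed

lemma II_1_9_combination:
  assumes "x \<in> vecs II_1_9" "y \<in> vecs II_1_9"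
  shows "of_int m *\<^sub>R x + of_int n *\<^sub>R y \<in> vecs II_1_9"
  using assms E8_combination by (auto simp: II_1_9_vecs U_lattice_def)

lemma II_1_9_self_dual: "{y. \<forall>x\<in>vecs II_1_9. form II_1_9 x y \<in> \<int>} = vecs II_1_9"
proof (intro equalityI subsetI)
  fix y assume "y \<in> {y. \<forall>x\<in>vecs II_1_9. form II_1_9 x y \<in> \<int>}"
  then have y: "form II_1_9 x y \<in> \<int>" if "x \<in> vecs II_1_9" for x using that by blast
  have z: "0 \<in> vecs U_lattice" "0 \<in> vecs E8_lattice"
    by (auto simp: U_lattice_def E8_lattice_def)
  have "axis 2 1 \<in> vecs U_lattice" "axis 1 1 \<in> vecs U_lattice"
    by (auto simp: U_lattice_def axis_def)
  with y [of "(axis 2 1, 0)"] y [of "(axis 1 1, 0)"] z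
  have "fst y $ 1 \<in> \<int>" "fst y $ 2 \<in> \<int>"
    by (auto simp: II_1_9_vecs II_1_9_form U_form axis_def)
  then have "fst y \<in> vecs U_lattice"
    by (simp add: U_lattice_def forall_2)
  moreover have "snd y \<in> vecs E8_lattice"
  proof (rule E8_dual)
    fix x assume "x \<in> vecs E8_lattice"
    with y [of "(0, x)"] z show "x \<bullet> snd y \<in> \<int>"
      by (simp add: II_1_9_vecs II_1_9_form U_form)
  qed
  ultimately show "y \<in> vecs II_1_9" by (simp add: II_1_9_vecs mem_Times_iff)
next
  fix y assume y: "y \<in> vecs II_1_9"
  have "form II_1_9 x y \<in> \<int>" if x: "x \<in> vecs II_1_9" for x
  proof -
    have "of_int 1 *\<^sub>R snd x + of_int 1 *\<^sub>R snd y \<in> vecs E8_lattice"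
      using x y E8_combination [of "snd x" "snd y" 1 1] by (simp add: II_1_9_vecs mem_Times_iff)
    then have "(snd x + snd y) \<bullet> (snd x + snd y) / 2 - snd x \<bullet> snd x / 2 - snd y \<bullet> snd y / 2 \<in> \<int>"
      using E8_even x y by (intro Ints_diff) (auto simp: II_1_9_vecs mem_Times_iff)
    then have "snd x \<bullet> snd y \<in> \<int>"
      by (simp add: inner_add_left inner_add_right inner_commute field_simps)
    moreover have "\<forall>i. fst x $ i \<in> \<int>" "\<forall>i. fst y $ i \<in> \<int>"
      using x y by (auto simp: II_1_9_vecs U_lattice_def)
    ultimately show ?thesis
      by (auto simp: II_1_9_form U_form)
  qed
  then show "y \<in> {y. \<forall>x\<in>vecs II_1_9. form II_1_9 x y \<in> \<int>}" by blast
qed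

lemma subgroup_lattice_auts:
  assumes L: "\<And>x y m n. x \<in> vecs \<Gamma> \<Longrightarrow> y \<in> vecs \<Gamma> \<Longrightarrow> of_int m *\<^sub>R x + of_int n *\<^sub>R y \<in> vecs \<Gamma>"
  shows "subgroup (lattice_auts \<Gamma>) (BijGroup (vecs \<Gamma>))"
proof (rule subgroup.intro)
  show "lattice_auts \<Gamma> \<subseteq> carrier (BijGroup (vecs \<Gamma>))"
    by (auto simp: lattice_auts_def BijGroup_def)
  show "\<one>\<^bsub>BijGroup (vecs \<Gamma>)\<^esub> \<in> lattice_auts \<Gamma>"
    using L by (simp add: BijGroup_def lattice_auts_def id_Bij)
next
  fix f g assume f: "f \<in> lattice_auts \<Gamma>" and g: "g \<in> lattice_auts \<Gamma>"
  have B: "f \<in> Bij (vecs \<Gamma>)" "g \<in> Bij (vecs \<Gamma>)" using f g by (auto simp: lattice_auts_def)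
  then have m: "g x \<in> vecs \<Gamma>" if "x \<in> vecs \<Gamma>" for x
    using that Bij_imp_funcset by blast
  show "f \<otimes>\<^bsub>BijGroup (vecs \<Gamma>)\<^esub> g \<in> lattice_auts \<Gamma>"
    using f g B m L by (simp add: BijGroup_def lattice_auts_def compose_Bij compose_eq)
next
  fix f assume f: "f \<in> lattice_auts \<Gamma>"
  let ?L = "vecs \<Gamma>" and ?h = "inv_into (vecs \<Gamma>) f"
  have B: "f \<in> Bij ?L" using f by (simp add: lattice_auts_def)
  then have im: "f ` ?L = ?L" and inj: "inj_on f ?L" by (auto simp: Bij_def bij_betw_def)
  have h: "?h x \<in> ?L" "f (?h x) = x" if "x \<in> ?L" for x
    using that im by (auto intro: inv_into_into f_inv_into_f)
  have lin: "?h (of_int m *\<^sub>R x + of_int n *\<^sub>R y) = of_int m *\<^sub>R ?h x + of_int n *\<^sub>R ?h y"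
    if "x \<in> ?L" "y \<in> ?L" for x y and m n :: int
  proof (rule inv_into_f_eq [OF inj])
    show "of_int m *\<^sub>R ?h x + of_int n *\<^sub>R ?h y \<in> ?L" using L h that by blast
    show "f (of_int m *\<^sub>R ?h x + of_int n *\<^sub>R ?h y) = of_int m *\<^sub>R x + of_int n *\<^sub>R y"
      using f h that by (simp add: lattice_auts_def)
  qed
  have iso: "form \<Gamma> (?h x) (?h y) = form \<Gamma> x y" if "x \<in> ?L" "y \<in> ?L" for x y
  proof -
    have "form \<Gamma> (f (?h x)) (f (?h y)) = form \<Gamma> (?h x) (?h y)"
      using f h(1) that unfolding lattice_auts_def by blast
    then show ?thesis using h that by simp
  qed
  show "inv\<^bsub>BijGroup ?L\<^esub> f \<in> lattice_auts \<Gamma>"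
    using lin iso L restrict_inv_into_Bij [OF B]
    by (simp add: inv_BijGroup [OF B] lattice_auts_def)
qed

lemma group_Aut_II_1_9: "group (Aut II_1_9)"
  unfolding Aut_def
  by (intro subgroup.subgroup_is_group subgroup_lattice_auts II_1_9_combination group_BijGroup)

end

theory Submission
  imports Defs
begin

text \<open>
  Write a vector as \<open>(a, b, v)\<close>, of norm \<open>2ab - v\<^sup>2\<close>. If \<open>a \<noteq> 0\<close>, an Eichler transvection changes
  \<open>v\<close> by any element of \<open>a E\<^sub>8\<close>. Every point of \<open>\<real>\<^sup>8\<close> has squared distance less than 2 from
  \<open>E\<^sub>8\<close>, so one may achieve \<open>v\<^sup>2 < 2a\<^sup>2\<close>; for a null vector this says \<open>\<bar>b\<bar> < \<bar>a\<bar>\<close>. Exchanging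
  \<open>a\<close> and \<open>b\<close> and iterating leads to \<open>a = 0\<close>, where \<open>v = 0\<close> and primitivity gives \<open>b = \<plusminus>1\<close>.
\<close>

section \<open>Approximation by the \<open>E\<^sub>8\<close> lattice\<close>

text \<open>Coordinatewise rounding leaves eight errors of at most 1/2, hence squared distance at
  most 2, with equality only if every coordinate is half-integral. That exceptional case is served
  by the half-integral vectors of the lattice instead.\<close>

lemma E8_close:
  fixes v :: "real^8"
  obtains w where "w \<in> vecs E8_lattice" "(v - w) \<bullet> (v - w) < 2"
proof (cases "\<forall>i. v $ i - 1 / 2 \<in> \<int>")
  case True
  have "(\<Sum>i\<in>UNIV. v $ i - 1 / 2) \<in> \<int>" using True by (intro Ints_sum) auto
  \<comment> \<open>The eight subtracted halves add up to 4.\<close>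
  then have "(\<Sum>i\<in>UNIV. v $ i - 1 / 2) + 4 \<in> \<int>" by (intro Ints_add) auto
  then have "(\<Sum>i\<in>UNIV. v $ i) \<in> \<int>" by (simp add: sum_subtractf)
  then obtain k where k: "(\<Sum>i\<in>UNIV. v $ i) = of_int k" by (rule Ints_cases)
  show ?thesis
  proof (cases "even k")
    case even: True
    then have "(\<Sum>i\<in>UNIV. v $ i) / 2 \<in> \<int>" using k by (auto elim!: evenE)
    then have "v \<in> vecs E8_lattice" using True by (simp add: E8_lattice_def)
    then show ?thesis using that [of v] by simp
  next
    case False
    let ?w = "v - axis 1 1"
    have "(\<Sum>i\<in>UNIV. ?w $ i) = of_int k - 1"
      using k by (simp add: sum_subtractf axis_def)
    then have "(\<Sum>i\<in>UNIV. ?w $ i) / 2 \<in> \<int>" using False by (auto elim!: oddE)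
    moreover have "\<forall>i. ?w $ i - 1 / 2 \<in> \<int>"
    proof
      fix i
      have "v $ i - 1 / 2 - axis 1 1 $ i \<in> \<int>"
        using True by (intro Ints_diff [of "v $ i - 1 / 2"]) (auto simp: axis_def)
      then show "?w $ i - 1 / 2 \<in> \<int>" by (simp add: algebra_simps)
    qed
    ultimately have "?w \<in> vecs E8_lattice" unfolding E8_lattice_def by simp
    then show ?thesis using that [of ?w] by (simp add: inner_axis')
  qed
next
  case False
  then obtain i0 where i0: "v $ i0 - 1 / 2 \<notin> \<int>" by blast
  define d where "d i = v $ i - of_int (round (v $ i))" for i
  have dle: "\<bar>d i\<bar> \<le> 1 / 2" for i
    using of_int_round_abs_le [of "v $ i"] by (simp add: d_def abs_minus_commute)
  \<comment> \<open>An error of exactly 1/2 would make the coordinate \<open>i0\<close>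
    half-integral; this one coordinate makes the bound \<open>S < 2\<close> strict.\<close>
  have "\<bar>d i0\<bar> \<noteq> 1 / 2"
  proof
    assume "\<bar>d i0\<bar> = 1 / 2"
    then consider "v $ i0 - 1 / 2 = of_int (round (v $ i0))"
      | "v $ i0 - 1 / 2 = of_int (round (v $ i0) - 1)"
      by (auto simp: d_def abs_if split: if_splits)
    then show False using i0 by cases (metis Ints_of_int)+
  qed
  with dle [of i0] have d0: "\<bar>d i0\<bar> < 1 / 2" by simp
  define M where "M = Max (range (\<lambda>i. \<bar>d i\<bar>))"
  have dM: "\<bar>d i\<bar> \<le> M" for i by (simp add: M_def)
  have "M \<in> range (\<lambda>i. \<bar>d i\<bar>)" unfolding M_def by (intro Max_in) auto
  then obtain j where j: "M = \<bar>d j\<bar>" by blast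
  define S where "S = (\<Sum>i\<in>UNIV. (d i)\<^sup>2)"
  have "S < (\<Sum>i\<in>(UNIV::8 set). (1 / 2)\<^sup>2)"
    unfolding S_def
  proof (rule sum_strict_mono_ex1)
    show "\<forall>i\<in>UNIV. (d i)\<^sup>2 \<le> (1 / 2)\<^sup>2"
      using dle abs_le_square_iff [of "d _" "1/2"] by auto
    show "\<exists>i\<in>UNIV. (d i)\<^sup>2 < (1 / 2)\<^sup>2"
      using power_strict_mono [OF d0, of 2] by (intro bexI [of _ i0]) (simp_all only: power2_abs, simp_all)
  qed simp
  then have S2: "S < 2" by (simp add: power2_eq_square)
  have "S \<le> (\<Sum>i\<in>(UNIV::8 set). M\<^sup>2)"
    unfolding S_def by (intro sum_mono) (metis dM abs_le_square_iff abs_of_nonneg j abs_ge_zero)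
  then have SM: "S \<le> 8 * M\<^sup>2" by simp
  define x :: "real^8" where "x = (\<chi> i. of_int (round (v $ i)))"
  define k where "k = (\<Sum>i\<in>UNIV. round (v $ i))"
  have k: "(\<Sum>i\<in>UNIV. x $ i) = of_int k" by (simp add: k_def x_def)
  have vx: "(v - x) $ i = d i" for i by (simp add: x_def d_def)
  then have vxS: "(v - x) \<bullet> (v - x) = S" by (simp add: inner_vec_def S_def power2_eq_square)
  show ?thesis
  proof (cases "even k")
    case True
    then have "x \<in> vecs E8_lattice"
      using k by (auto simp: E8_lattice_def x_def elim!: evenE)
    then show ?thesis using that [of x] S2 vxS by simp
  next
    case odd: False
    \<comment> \<open>Rounding the coordinate of largest error \<open>M\<close> the other way repairs the parity and adds
      \<open>1 - 2M\<close> to the squared distance.\<close>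
    define s :: int where "s = (if d j \<ge> 0 then 1 else - 1)"
    have s: "odd s" "s * s = 1" "of_int s * d j = M" by (auto simp: s_def j)
    let ?w = "x + of_int s *\<^sub>R axis j 1"
    have "(\<Sum>i\<in>UNIV. axis j 1 $ i) = (1::real)" by (simp add: axis_def)
    then have "(\<Sum>i\<in>UNIV. ?w $ i) = of_int (k + s)"
      using k by (simp only: vector_add_component vector_scaleR_component real_scaleR_def sum.distrib
          sum_distrib_left [symmetric] of_int_add mult_1_right)
    moreover obtain m where "k + s = 2 * m" using odd s by (meson odd_even_add evenE)
    ultimately have "(\<Sum>i\<in>UNIV. ?w $ i) / 2 = of_int m" by (simp del: of_int_add)
    then have "(\<Sum>i\<in>UNIV. ?w $ i) / 2 \<in> \<int>" by (metis Ints_of_int)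
    moreover have "?w $ i \<in> \<int>" for i by (simp add: x_def axis_def)
    ultimately have w: "?w \<in> vecs E8_lattice" by (simp add: E8_lattice_def)
    have "(v - ?w) \<bullet> (v - ?w) = S - 2 * (of_int s * d j) + of_int (s * s)"
    proof -
      have "v - ?w = (v - x) - of_int s *\<^sub>R axis j 1" by simp
      then show ?thesis
        using vxS vx [of j]
        by (simp only: inner_diff_left inner_diff_right inner_scaleR_left inner_scaleR_right
            inner_axis inner_axis') (simp add: algebra_simps)
    qed
    then have e: "(v - ?w) \<bullet> (v - ?w) = S - 2 * M + 1" using s by simp
    have "S - 2 * M + 1 < 2"
    proof (cases "M = 1 / 2")
      case True
      with S2 show ?thesis by simp
    next
      case False
      have "0 \<le> M" "M \<le> 1 / 2" using dle j by auto
      \<comment> \<open>The product equals 8 M^2 - 2 M - 1, which bounds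
        \<open>S - 2 * M - 1\<close> by \<open>SM\<close>. It vanishes at M = 1/2, where the strict
        bound \<open>S2\<close> takes over.\<close>
      with False have "(2 * M - 1) * (4 * M + 1) < 0" by (intro mult_neg_pos) auto
      with SM show ?thesis by (simp add: algebra_simps power2_eq_square)
    qed
    with e w that [of ?w] show ?thesis by simp
  qed
qed

section \<open>Lattice automorphisms\<close>

lemma lattice_autsD:
  assumes "f \<in> lattice_auts \<Gamma>" and "x \<in> vecs \<Gamma>"
  shows "f x \<in> vecs \<Gamma>" and "y \<in> vecs \<Gamma> \<Longrightarrow> form \<Gamma> (f x) (f y) = form \<Gamma> x y"
    and "f (of_int k *\<^sub>R x) = of_int k *\<^sub>R f x"
proof -
  show "f x \<in> vecs \<Gamma>"
    using assms Bij_imp_funcset [of f "vecs \<Gamma>"] by (auto simp: lattice_auts_def)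
  show "form \<Gamma> (f x) (f y) = form \<Gamma> x y" if "y \<in> vecs \<Gamma>"
    using assms that by (simp add: lattice_auts_def)
  have "f (of_int k *\<^sub>R x + of_int 0 *\<^sub>R x) = of_int k *\<^sub>R f x + of_int 0 *\<^sub>R f x"
    using assms unfolding lattice_auts_def by blast
  then show "f (of_int k *\<^sub>R x) = of_int k *\<^sub>R f x" by simp
qed

text \<open>Automorphisms are extensional, so a linear isometry of the ambient space becomes one
  only after restriction; the explicit inverse \<open>g\<close> supplies bijectivity on the
  lattice.\<close>

lemma lattice_auts_restrictI:
  assumes "linear f"
    and "\<And>x. x \<in> vecs \<Gamma> \<Longrightarrow> f x \<in> vecs \<Gamma>" "\<And>x. x \<in> vecs \<Gamma> \<Longrightarrow> g x \<in> vecs \<Gamma>"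
    and "\<And>x. g (f x) = x" "\<And>x. f (g x) = x"
    and "\<And>x y. form \<Gamma> (f x) (f y) = form \<Gamma> x y"
    and L: "\<And>x y m n. x \<in> vecs \<Gamma> \<Longrightarrow> y \<in> vecs \<Gamma> \<Longrightarrow> of_int m *\<^sub>R x + of_int n *\<^sub>R y \<in> vecs \<Gamma>"
  shows "restrict f (vecs \<Gamma>) \<in> lattice_auts \<Gamma>"
proof -
  have "bij_betw f (vecs \<Gamma>) (vecs \<Gamma>)"
    using assms by (intro bij_betw_byWitness [where f' = g]) auto
  then have "restrict f (vecs \<Gamma>) \<in> Bij (vecs \<Gamma>)"
    by (simp add: Bij_def)
  then show ?thesis
    using assms by (simp add: lattice_auts_def linear_add linear_scale)
qed

text \<open>A factorisation of \<open>f u\<close> as k times a lattice vector pulls back along the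
  bijection \<open>f\<close> to one of \<open>u\<close>, so primitivity is invariant.\<close>

lemma primitive_null_aut:
  assumes f: "f \<in> lattice_auts \<Gamma>" and u: "u \<in> primitive_null \<Gamma>"
    and L: "\<And>x y m n. x \<in> vecs \<Gamma> \<Longrightarrow> y \<in> vecs \<Gamma> \<Longrightarrow> of_int m *\<^sub>R x + of_int n *\<^sub>R y \<in> vecs \<Gamma>"
  shows "f u \<in> primitive_null \<Gamma>"
proof -
  have uL: "u \<in> vecs \<Gamma>" using u by (simp add: primitive_null_def primitive_in_def)
  have B: "inj_on f (vecs \<Gamma>)" "f ` vecs \<Gamma> = vecs \<Gamma>"
    using f by (auto simp: lattice_auts_def Bij_def bij_betw_def)
  have False if k: "k > 1" and w: "w \<in> vecs \<Gamma>" "f u = of_int k *\<^sub>R w" for k :: int and w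
  proof -
    obtain w' where w': "w' \<in> vecs \<Gamma>" "w = f w'" using w B(2) by blast
    have "f (of_int k *\<^sub>R w') = f u" using lattice_autsD(3) [OF f w'(1)] w w' by simp
    moreover have "of_int k *\<^sub>R w' \<in> vecs \<Gamma>" using L [OF w'(1) w'(1), of k 0] by simp
    ultimately have "u = of_int k *\<^sub>R w'" using B(1) uL by (simp add: inj_on_def)
    then show False using u k w' by (auto simp: primitive_null_def primitive_in_def)
  qed
  then show ?thesis
    using lattice_autsD [OF f uL] uL u by (auto simp: primitive_null_def primitive_in_def vec_norm_def)
qed

lemma lattice_auts_compose:
  assumes L: "\<And>x y m n. x \<in> vecs \<Gamma> \<Longrightarrow> y \<in> vecs \<Gamma> \<Longrightarrow> of_int m *\<^sub>R x + of_int n *\<^sub>R y \<in> vecs \<Gamma>"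
    and "f \<in> lattice_auts \<Gamma>" "g \<in> lattice_auts \<Gamma>"
  shows "compose (vecs \<Gamma>) f g \<in> lattice_auts \<Gamma>"
  using subgroup.m_closed [OF subgroup_lattice_auts [OF L], of f g] assms
  by (simp add: BijGroup_def lattice_auts_def)

lemma lattice_auts_inverse:
  assumes L: "\<And>x y m n. x \<in> vecs \<Gamma> \<Longrightarrow> y \<in> vecs \<Gamma> \<Longrightarrow> of_int m *\<^sub>R x + of_int n *\<^sub>R y \<in> vecs \<Gamma>"
    and f: "f \<in> lattice_auts \<Gamma>"
  shows "restrict (inv_into (vecs \<Gamma>) f) (vecs \<Gamma>) \<in> lattice_auts \<Gamma>"
proof -
  have "f \<in> Bij (vecs \<Gamma>)" using f by (simp add: lattice_auts_def)
  then show ?thesis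
    using subgroup.m_inv_closed [OF subgroup_lattice_auts [OF L] f] by (simp add: inv_BijGroup)
qed

section \<open>Reduction of null vectors\<close>

lemma E8_inner_Ints:
  assumes "x \<in> vecs E8_lattice" "y \<in> vecs E8_lattice"
  shows "x \<bullet> y \<in> \<int>"
proof -
  have "x + y \<in> vecs E8_lattice" using E8_combination [OF assms, of 1 1] by simp
  \<comment> \<open>Polarisation: evenness is applied to \<open>x + y\<close>, \<open>x\<close> and
    \<open>y\<close>.\<close>
  then have "(x + y) \<bullet> (x + y) / 2 - x \<bullet> x / 2 - y \<bullet> y / 2 \<in> \<int>"
    using assms by (intro Ints_diff E8_even)
  then show ?thesis
    by (simp add: inner_add_left inner_add_right inner_commute field_simps)
qed

text \<open>With (.,.) the form of \<open>II_1_9\<close> and e = (0, 1, 0), this is the transvection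
  u + (u,e) w - (u,w) e - (w,w)/2 (u,e) e. The negated E8 summand turns the minus signs into
  plus.\<close>

definition eichler :: "real^8 \<Rightarrow> (real^2) \<times> (real^8) \<Rightarrow> (real^2) \<times> (real^8)" where
  "eichler w u =
     (vector [fst u $ 1, fst u $ 2 + snd u \<bullet> w + fst u $ 1 * (w \<bullet> w / 2)], snd u + fst u $ 1 *\<^sub>R w)"

definition swap_U :: "(real^2) \<times> (real^8) \<Rightarrow> (real^2) \<times> (real^8)" where
  "swap_U u = (vector [fst u $ 2, fst u $ 1], snd u)"

text \<open>Evenness of E8 makes the quadratic term \<open>w \<bullet> w / 2\<close>
  integral.\<close>

lemma eichler_vecs:
  assumes "w \<in> vecs E8_lattice" "u \<in> vecs II_1_9"
  shows "eichler w u \<in> vecs II_1_9"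
proof -
  have u: "fst u $ 1 \<in> \<int>" "fst u $ 2 \<in> \<int>" "snd u \<in> vecs E8_lattice"
    using assms by (auto simp: II_1_9_vecs U_lattice_def)
  obtain m where m: "fst u $ 1 = of_int m" using u(1) by (rule Ints_cases)
  have "snd u + fst u $ 1 *\<^sub>R w \<in> vecs E8_lattice"
    using E8_combination [OF u(3) assms(1), of 1 m] m by simp
  moreover have "fst u $ 2 + snd u \<bullet> w + fst u $ 1 * (w \<bullet> w / 2) \<in> \<int>"
    using u assms by (intro Ints_add Ints_mult E8_inner_Ints E8_even)
  ultimately show ?thesis
    using u by (simp add: eichler_def II_1_9_vecs U_lattice_def forall_2)
qed

lemma eichler_inverse: "eichler (- w) (eichler w u) = u"
  by (simp add: eichler_def prod_eq_iff vec_eq_iff forall_2 inner_add_left algebra_simps)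

lemma eichler_aut:
  assumes w: "w \<in> vecs E8_lattice"
  shows "restrict (eichler w) (vecs II_1_9) \<in> lattice_auts II_1_9"
proof (rule lattice_auts_restrictI [where g = "eichler (- w)"])
  show "linear (eichler w)"
    by (rule linearI)
      (simp_all add: eichler_def prod_eq_iff vec_eq_iff forall_2 inner_add_left algebra_simps add_divide_distrib)
  have "- w \<in> vecs E8_lattice" using E8_combination [OF w w, of "- 1" 0] by simp
  then show "eichler (- w) x \<in> vecs II_1_9" if "x \<in> vecs II_1_9" for x
    using that by (rule eichler_vecs)
  show "eichler w (eichler (- w) x) = x" for x using eichler_inverse [of "- w"] by simp
  \<comment> \<open>The shift of the second coordinate compensates exactly for the change in the E8
    inner product.\<close>
  show "form II_1_9 (eichler w x) (eichler w y) = form II_1_9 x y" for x y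
    by (simp add: II_1_9_form U_form eichler_def inner_add_left inner_add_right inner_commute algebra_simps)
qed (use w eichler_vecs eichler_inverse II_1_9_combination in auto)

lemma swap_U_aut: "restrict swap_U (vecs II_1_9) \<in> lattice_auts II_1_9"
proof (rule lattice_auts_restrictI [where g = swap_U])
  show "linear swap_U"
    by (rule linearI) (simp_all add: swap_U_def prod_eq_iff vec_eq_iff forall_2)
  show "swap_U x \<in> vecs II_1_9" if "x \<in> vecs II_1_9" for x
    using that by (auto simp: swap_U_def II_1_9_vecs U_lattice_def forall_2)
  then show "swap_U x \<in> vecs II_1_9" if "x \<in> vecs II_1_9" for x using that .
  show "form II_1_9 (swap_U x) (swap_U y) = form II_1_9 x y" for x y
    by (simp add: swap_U_def II_1_9_form U_form)
qed (use II_1_9_combination in \<open>auto simp: swap_U_def prod_eq_iff vec_eq_iff forall_2\<close>)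

lemma uminus_aut: "restrict uminus (vecs II_1_9) \<in> lattice_auts II_1_9"
proof (rule lattice_auts_restrictI [where g = uminus])
  show "- x \<in> vecs II_1_9" if "x \<in> vecs II_1_9" for x
    using II_1_9_combination [OF that that, of "- 1" 0] by simp
  then show "- x \<in> vecs II_1_9" if "x \<in> vecs II_1_9" for x using that .
qed (use II_1_9_combination in \<open>auto simp: II_1_9_form U_form linear_iff\<close>)

section \<open>The base point of the orbit, and null vectors in coordinates\<close>

definition e_null :: "(real^2) \<times> (real^8)" where
  "e_null = (vector [1, 0], 0)"

lemma e_null_primitive: "e_null \<in> primitive_null II_1_9"
proof -
  have "0 \<in> vecs E8_lattice" by (simp add: E8_lattice_def)
  then have "e_null \<in> vecs II_1_9" by (simp add: II_1_9_vecs U_lattice_def e_null_def forall_2)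
  moreover have False if k: "k > 1" and w: "w \<in> vecs II_1_9" "e_null = of_int k *\<^sub>R w" for k :: int and w
  proof -
    have "fst w $ 1 \<in> \<int>" using w by (auto simp: II_1_9_vecs U_lattice_def)
    then obtain m where m: "fst w $ 1 = of_int m" by (rule Ints_cases)
    \<comment> \<open>Comparing first coordinates would make 1 a multiple of k > 1.\<close>
    have "fst e_null $ 1 = of_int k * fst w $ 1" unfolding w(2) by simp
    then have "(1::real) = of_int (k * m)" using m by (simp add: e_null_def)
    then have "k * m = 1" by linarith
    then show False using k by (auto simp: zmult_eq_1_iff)
  qed
  ultimately show ?thesis
    by (auto simp: primitive_null_def primitive_in_def vec_norm_def II_1_9_form U_form) (simp add: e_null_def)
qed

text \<open>The last conclusion, v^2 = 2ab, is what converts a bound on the E8 part into a bound on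
  b.\<close>

lemma primitive_null_II_1_9D:
  assumes "u \<in> primitive_null II_1_9"
  shows "u \<in> vecs II_1_9" "fst u $ 1 \<in> \<int>" "fst u $ 2 \<in> \<int>" "snd u \<in> vecs E8_lattice"
    and "snd u \<bullet> snd u = 2 * (fst u $ 1 * fst u $ 2)"
  using assms
proof -
  show L: "u \<in> vecs II_1_9" using assms by (simp add: primitive_null_def primitive_in_def)
  then show "fst u $ 1 \<in> \<int>" "fst u $ 2 \<in> \<int>" "snd u \<in> vecs E8_lattice"
    by (auto simp: II_1_9_vecs U_lattice_def)
  show "snd u \<bullet> snd u = 2 * (fst u $ 1 * fst u $ 2)"
    using assms by (simp add: primitive_null_def vec_norm_def II_1_9_form U_form)
qed

lemmas primitive_null_aut_II_1_9 = primitive_null_aut [where \<Gamma> = II_1_9, OF _ _ II_1_9_combination]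

lemma aut_compose_apply:
  assumes "f \<in> lattice_auts II_1_9" "g \<in> lattice_auts II_1_9" "u \<in> vecs II_1_9" "f (g u) = v"
  shows "\<exists>h\<in>lattice_auts II_1_9. h u = v"
  using lattice_auts_compose [OF II_1_9_combination assms(1,2)] assms(3,4)
  by (intro bexI [of _ "compose (vecs II_1_9) f g"]) (simp_all add: compose_eq)

section \<open>Descent to the base point, and transitivity\<close>

lemma primitive_null_degenerate:
  assumes u: "u \<in> primitive_null II_1_9" and a: "fst u $ 1 = 0"
  shows "\<exists>f\<in>lattice_auts II_1_9. f u = e_null"
proof -
  note D = primitive_null_II_1_9D [OF u]
  have v: "snd u = 0" using D(5) a by simp
  obtain b where b: "fst u $ 2 = of_int b" using D(3) by (rule Ints_cases)
  have nd: False if "k > 1" "b = k * c" for k c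
  proof -
    let ?w = "(vector [0, of_int c], 0) :: (real^2) \<times> (real^8)"
    have "?w \<in> vecs II_1_9" using D(4) v by (simp add: II_1_9_vecs U_lattice_def forall_2)
    moreover have "u = of_int k *\<^sub>R ?w"
      using a v b that by (simp add: prod_eq_iff vec_eq_iff forall_2)
    ultimately show False
      using u that unfolding primitive_null_def primitive_in_def by blast
  qed
  have "\<bar>b\<bar> = 1"
  proof -
    \<comment> \<open>0 is divisible by 2, and b with |b| > 1 is divisible by |b|, with quotient
      \<open>sgn b\<close>; both contradict primitivity.\<close>
    have "b \<noteq> 0" using nd [of 2 0] by auto
    moreover have "\<not> \<bar>b\<bar> > 1" using nd [of "\<bar>b\<bar>" "sgn b"] by (auto simp: abs_mult_sgn)
    ultimately show ?thesis by linarith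
  qed
  then consider "b = 1" | "b = - 1" by linarith
  then show ?thesis
  proof cases
    case 1
    then have "swap_U u = e_null"
      using a b v by (simp add: swap_U_def e_null_def)
    then show ?thesis using swap_U_aut D(1) by (intro bexI [OF _ swap_U_aut]) simp
  next
    case 2
    then have "- swap_U u = e_null"
      using a b v by (simp add: swap_U_def e_null_def prod_eq_iff vec_eq_iff forall_2)
    moreover have "swap_U u \<in> vecs II_1_9"
      using lattice_autsD(1) [OF swap_U_aut D(1)] D(1) by simp
    ultimately show ?thesis
      using D(1) by (intro aut_compose_apply [OF uminus_aut swap_U_aut]) simp_all
  qed
qed

text \<open>Euclidean descent on |a|. The coordinate is a real number with integer value, so
  \<open>nat\<close> and the floor yield a natural-number measure without loss.\<close>

lemma primitive_null_to_e_null: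
  assumes "u \<in> primitive_null II_1_9"
  shows "\<exists>f\<in>lattice_auts II_1_9. f u = e_null"
  using assms
proof (induction "nat \<lfloor>\<bar>fst u $ 1\<bar>\<rfloor>" arbitrary: u rule: less_induct)
  case less
  note D = primitive_null_II_1_9D [OF less.prems]
  show ?case
  proof (cases "fst u $ 1 = 0")
    case True
    with less.prems show ?thesis by (rule primitive_null_degenerate)
  next
    case False
    let ?a = "fst u $ 1"
    \<comment> \<open>Approximating -v/a makes v + a w, which is -a times the approximation error,
      short relative to |a|.\<close>
    obtain w where w: "w \<in> vecs E8_lattice"
      and wd: "(- (1 / ?a) *\<^sub>R snd u - w) \<bullet> (- (1 / ?a) *\<^sub>R snd u - w) < 2"
      by (rule E8_close)
    define u1 where "u1 = restrict (eichler w) (vecs II_1_9) u"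
    have u1: "u1 = eichler w u" using D(1) by (simp add: u1_def)
    have P1: "u1 \<in> primitive_null II_1_9"
      unfolding u1_def using eichler_aut [OF w] less.prems by (rule primitive_null_aut_II_1_9)
    note D1 = primitive_null_II_1_9D [OF P1]
    define u2 where "u2 = restrict swap_U (vecs II_1_9) u1"
    have u2: "u2 = swap_U u1" using D1(1) by (simp add: u2_def)
    have P2: "u2 \<in> primitive_null II_1_9"
      unfolding u2_def using swap_U_aut P1 by (rule primitive_null_aut_II_1_9)
    have a1: "fst u1 $ 1 = ?a" by (simp add: u1 eichler_def)
    have "snd u1 = (- ?a) *\<^sub>R (- (1 / ?a) *\<^sub>R snd u - w)"
      using False by (simp add: u1 eichler_def algebra_simps)
    then have "snd u1 \<bullet> snd u1 = ?a\<^sup>2 * ((- (1 / ?a) *\<^sub>R snd u - w) \<bullet> (- (1 / ?a) *\<^sub>R snd u - w))"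
      by (simp only: inner_scaleR_left inner_scaleR_right power2_eq_square)
    also have "\<dots> < ?a\<^sup>2 * 2" using wd False by (intro mult_strict_left_mono) auto
    \<comment> \<open>The squared length of \<open>snd u1\<close> is twice the product of the two
      hyperbolic coordinates; the first of these is still a.\<close>
    finally have "?a * fst u1 $ 2 < ?a\<^sup>2" using D1(5) a1 by simp
    \<comment> \<open>Half a squared length is nonnegative, which allows passing to absolute values
      and cancelling |a|.\<close>
    moreover have "0 \<le> ?a * fst u1 $ 2" using D1(5) a1 by (metis inner_ge_zero zero_le_mult_iff zero_less_numeral not_le)
    ultimately have "\<bar>?a\<bar> * \<bar>fst u1 $ 2\<bar> < \<bar>?a\<bar> * \<bar>?a\<bar>"
      by (simp add: abs_mult [symmetric] power2_eq_square)
    then have lt: "\<bar>fst u1 $ 2\<bar> < \<bar>?a\<bar>" by (rule mult_left_less_imp_less) simp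
    have e2: "fst u2 $ 1 = fst u1 $ 2" by (simp add: u2 swap_U_def)
    obtain m n where "?a = of_int m" "fst u1 $ 2 = of_int n" using D(2) D1(3) by (metis Ints_cases)
    then have "nat \<lfloor>\<bar>fst u2 $ 1\<bar>\<rfloor> < nat \<lfloor>\<bar>?a\<bar>\<rfloor>" using lt e2 by (simp flip: of_int_abs)
    from less.hyps [OF this P2] obtain f where f: "f \<in> lattice_auts II_1_9" "f u2 = e_null"
      by (rule bexE)
    \<comment> \<open>The automorphism is assembled backwards: first the swap, then the
      transvection, is composed on the right.\<close>
    from aut_compose_apply [OF f(1) swap_U_aut D1(1) f(2) [unfolded u2_def]]
    obtain g where g: "g \<in> lattice_auts II_1_9" "g u1 = e_null" by (rule bexE)
    show ?thesis
      by (rule aut_compose_apply [OF g(1) eichler_aut [OF w] D(1) g(2) [unfolded u1_def]])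
  qed
qed

lemma primitive_null_transitive:
  assumes u: "u \<in> primitive_null II_1_9" and v: "v \<in> primitive_null II_1_9"
  shows "\<exists>f\<in>lattice_auts II_1_9. f u = v"
proof -
  from primitive_null_to_e_null [OF u] obtain f where f: "f \<in> lattice_auts II_1_9" "f u = e_null"
    by (rule bexE)
  from primitive_null_to_e_null [OF v] obtain g where g: "g \<in> lattice_auts II_1_9" "g v = e_null"
    by (rule bexE)
  \<comment> \<open>The inverse of \<open>g\<close> leads from \<open>e_null\<close> back to
    \<open>v\<close>; it is composed with \<open>f\<close>.\<close>
  have "inj_on g (vecs II_1_9)" using g by (simp add: lattice_auts_def Bij_def bij_betw_def)
  then have "inv_into (vecs II_1_9) g e_null = v"
    using g primitive_null_II_1_9D(1) [OF v] by (metis inv_into_f_f)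
  then have "restrict (inv_into (vecs II_1_9) g) (vecs II_1_9) (f u) = v"
    using f primitive_null_II_1_9D(1) [OF e_null_primitive] by simp
  then show ?thesis
    using lattice_auts_inverse [OF II_1_9_combination g(1)] f(1) primitive_null_II_1_9D(1) [OF u]
    by (intro aut_compose_apply)
qed

theorem theorem2:
  shows "primitive_null II_1_9 \<noteq> {} \<and>
         orbits (Aut II_1_9) (primitive_null II_1_9) (\<lambda>g. g) = {primitive_null II_1_9}"
proof (intro conjI equalityI subsetI)
  \<comment> \<open>Group elements are themselves functions, so the action is the identity map.
    Invariance of primitive null vectors gives one inclusion, transitivity the other.\<close>
  have orbit: "orbit (Aut II_1_9) (\<lambda>g. g) u = primitive_null II_1_9" if "u \<in> primitive_null II_1_9" for u
  proof -
    have "orbit (Aut II_1_9) (\<lambda>g. g) u = (\<lambda>g. g u) ` lattice_auts II_1_9"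
      by (simp add: orbit_def Aut_def Setcompr_eq_image)
    also have "\<dots> = primitive_null II_1_9"
    proof (intro equalityI subsetI)
      fix v assume "v \<in> (\<lambda>g. g u) ` lattice_auts II_1_9"
      then obtain g where "v = g u" "g \<in> lattice_auts II_1_9" by (rule imageE)
      then show "v \<in> primitive_null II_1_9" using primitive_null_aut_II_1_9 [OF _ that] by simp
    next
      fix v assume "v \<in> primitive_null II_1_9"
      from primitive_null_transitive [OF that this]
      obtain g where "g \<in> lattice_auts II_1_9" "g u = v" by (rule bexE)
      then show "v \<in> (\<lambda>g. g u) ` lattice_auts II_1_9" by (intro image_eqI [of _ _ g]) simp_all
    qed
    finally show ?thesis .
  qed
  show "primitive_null II_1_9 \<noteq> {}" using e_null_primitive by blast
  show "X \<in> {primitive_null II_1_9}"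
    if "X \<in> orbits (Aut II_1_9) (primitive_null II_1_9) (\<lambda>g. g)" for X
    using that orbit by (simp add: orbits_def) (elim exE conjE, simp)
  show "X \<in> orbits (Aut II_1_9) (primitive_null II_1_9) (\<lambda>g. g)"
    if "X \<in> {primitive_null II_1_9}" for X
    unfolding orbits_def
  proof (intro CollectI exI conjI)
    \<comment> \<open>The orbit of \<open>e_null\<close> ensures that the set of orbits is not
      empty.\<close>
    show "X = orbit (Aut II_1_9) (\<lambda>g. g) e_null" using that orbit [OF e_null_primitive] by simp
  qed (rule e_null_primitive)
qed

end
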